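(* Let $S$ be a discrete semigroup, let $\mathcal{F}$ be a filter on $S$ such that $\overline{\mathcal{F}}$ is a closed subsemigroup of $\beta S$, and let $A\subseteq S$. The set $A$ is $\mathcal{F}$-quasi-central if and only if there exist a dynamical system $(X,\langle T_s\rangle_{s\in S})$, points $x$ and $y$ in $X$, and a neighbourhood $U$ of $y$ such that the pair $(x,y)$ is jointly intermittently $\mathcal{F}$-uniformly recurrent and $A=\{s\in S: T_s(x)\in U\}$.
   Context: $\beta S$ is the space of ultrafilters on $S$, with basic sets $\overline{A}=\{p\in\beta S: A\in p\}$. For $x\in S$, $A,G\subseteq S$ put $x^{-1}A=\{y\in S: xy\in A\}$ and $G^{-1}A=\bigcup_{x\in G}x^{-1}A$. The operation on $\beta S$: $A\in p\cdot q$ iff $\{x\in S: x^{-1}A\in q\}\in p$. $\overline{\mathcal{F}}=\{p\in\beta S:\mathcal{F}\subseteq p\}$; $K(\overline{\mathcal{F}})$ is the smallest two-sided ideal of the compact right topological semigroup $\overline{\mathcal{F}}$ and $cl\,K(\overline{\mathcal{F}})$ is its closure in $\beta S$. A set $C\subseteq S$ is $\mathcal{F}$-quasi-central if there is an idempotent $p\in cl\,K(\overline{\mathcal{F}})$ such that $C\in p$. A set $A\subseteq S$ is piecewise $\mathcal{F}$-syndetic if for every $V\in\mathcal{F}$ there are a finite $F_V\subseteq V$ and $W_V\in\mathcal{F}$ such that the family $\{(x^{-1}F_V^{-1}A)\cap V: V\in\mathcal{F},\ x\in W_V\}$ has the finite intersection property. A dynamical system $(X,\langle T_s\rangle_{s\in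 S})$ consists of a compact Hausdorff space $X$ and continuous maps $T_s:X\to X$ ($s\in S$) with $T_s\circ T_t=T_{st}$ for all $s,t\in S$. A pair $(x,y)\in X\times X$ is jointly intermittently $\mathcal{F}$-uniformly recurrent if for every neighbourhood $U$ of $y$ the set $\{s\in S: T_s(x)\in U\text{ and }T_s(y)\in U\}$ is piecewise $\mathcal{F}$-syndetic. *)

theory Defs
  imports "HOL-Analysis.Analysis"
begin

text \<open>
  Filters on the discrete semigroup \<open>S\<close> (the carrier of the type \<open>'a\<close>) are library filters, with
  membership \<open>A \<in> F\<close> rendered by \<open>A \<in> sets_of F\<close>.  In the library order, \<open>p \<le> F\<close> means
  \<open>sets_of F \<subseteq> sets_of p\<close>, and the improper filter is \<open>bot\<close>.
\<close>

definition sets_of :: "'a filter \<Rightarrow> 'a set set" where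
  "sets_of F = {A. eventually (\<lambda>s. s \<in> A) F}"

definition ultrafilters :: "'a filter set" where
  "ultrafilters = {p. p \<noteq> bot \<and> (\<forall>A. A \<in> sets_of p \<or> - A \<in> sets_of p)}"

definition basic_clopen :: "'a set \<Rightarrow> 'a filter set" where
  "basic_clopen A = {p \<in> ultrafilters. A \<in> sets_of p}"

definition beta :: "'a filter topology" where
  "beta = topology_generated_by (range basic_clopen)"

definition hull_of :: "'a filter \<Rightarrow> 'a filter set" where
  "hull_of F = {p \<in> ultrafilters. sets_of F \<subseteq> sets_of p}"

definition inv_translate :: "'a::semigroup_mult \<Rightarrow> 'a set \<Rightarrow> 'a set" where
  "inv_translate x A = {y. x * y \<in> A}"

definition inv_translates :: "'a::semigroup_mult set \<Rightarrow> 'a set \<Rightarrow> 'a set" where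
  "inv_translates G A = (\<Union>x\<in>G. inv_translate x A)"

definition filter_mult :: "'a::semigroup_mult filter \<Rightarrow> 'a filter \<Rightarrow> 'a filter"
    (infixl "\<odot>" 70) where
  "p \<odot> q = Abs_filter (\<lambda>P. {x. inv_translate x {s. P s} \<in> sets_of q} \<in> sets_of p)"

lemma mem_filter_mult_iff:
  "A \<in> sets_of (p \<odot> q) \<longleftrightarrow> {x. inv_translate x A \<in> sets_of q} \<in> sets_of p"
proof -
  have "is_filter (\<lambda>P. eventually (\<lambda>x. eventually (\<lambda>y. P (x * y)) q) p)"
  proof (rule is_filter.intro)
    fix P Q :: "'a \<Rightarrow> bool"
    assume "eventually (\<lambda>x. eventually (\<lambda>y. P (x * y)) q) p"
      and "eventually (\<lambda>x. eventually (\<lambda>y. Q (x * y)) q) p"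
    then show "eventually (\<lambda>x. eventually (\<lambda>y. P (x * y) \<and> Q (x * y)) q) p"
      by (rule eventually_elim2) (rule eventually_conj)
  next
    fix P Q :: "'a \<Rightarrow> bool"
    assume le: "\<forall>x. P x \<longrightarrow> Q x" and P: "eventually (\<lambda>x. eventually (\<lambda>y. P (x * y)) q) p"
    show "eventually (\<lambda>x. eventually (\<lambda>y. Q (x * y)) q) p"
      by (rule eventually_mono[OF P], erule eventually_mono) (use le in blast)
  qed simp
  then show ?thesis
    unfolding filter_mult_def sets_of_def inv_translate_def
    by (simp add: eventually_Abs_filter)
qed

definition closed_subsemigroup :: "'a::semigroup_mult filter set \<Rightarrow> bool" where
  "closed_subsemigroup H \<longleftrightarrow>
     closedin beta H \<and> H \<noteq> {} \<and> (\<forall>p\<in>H. \<forall>q\<in>H. p \<odot> q \<in> H)"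

definition two_sided_ideal :: "'a::semigroup_mult filter set \<Rightarrow> 'a filter set \<Rightarrow> bool" where
  "two_sided_ideal H I \<longleftrightarrow>
     I \<noteq> {} \<and> I \<subseteq> H \<and> (\<forall>p\<in>I. \<forall>q\<in>H. p \<odot> q \<in> I \<and> q \<odot> p \<in> I)"

text \<open>The least element is taken with respect to inclusion.\<close>

definition smallest_ideal :: "'a::semigroup_mult filter set \<Rightarrow> 'a filter set" where
  "smallest_ideal H = (LEAST I. two_sided_ideal H I)"

definition quasi_central :: "'a::semigroup_mult filter \<Rightarrow> 'a set \<Rightarrow> bool" where
  "quasi_central F C \<longleftrightarrow>
     (\<exists>p \<in> beta closure_of smallest_ideal (hull_of F). p \<odot> p = p \<and> C \<in> sets_of p)"

definition has_fip :: "'a set set \<Rightarrow> bool" where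
  "has_fip \<C> \<longleftrightarrow> (\<forall>\<D>. finite \<D> \<and> \<D> \<subseteq> \<C> \<longrightarrow> \<Inter>\<D> \<noteq> {})"

text \<open>\<open>G V\<close> and \<open>W V\<close> are the sets chosen for each member \<open>V\<close>; the family ranges over all \<open>V\<close> at once.\<close>

definition piecewise_syndetic :: "'a::semigroup_mult filter \<Rightarrow> 'a set \<Rightarrow> bool" where
  "piecewise_syndetic F A \<longleftrightarrow>
     (\<exists>G W. (\<forall>V \<in> sets_of F. finite (G V) \<and> G V \<subseteq> V \<and> W V \<in> sets_of F) \<and>
            has_fip {inv_translate x (inv_translates (G V) A) \<inter> V | V x.
                       V \<in> sets_of F \<and> x \<in> W V})"

definition dynamical_system :: "'b topology \<Rightarrow> ('a::semigroup_mult \<Rightarrow> 'b \<Rightarrow> 'b) \<Rightarrow> bool" where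
  "dynamical_system X T \<longleftrightarrow>
     compact_space X \<and> Hausdorff_space X \<and> (\<forall>s. continuous_map X X (T s)) \<and>
     (\<forall>s t. \<forall>x \<in> topspace X. T s (T t x) = T (s * t) x)"

text \<open>Neighbourhoods need not be open.\<close>

definition neighbourhood_in :: "'b topology \<Rightarrow> 'b \<Rightarrow> 'b set \<Rightarrow> bool" where
  "neighbourhood_in X y U \<longleftrightarrow>
     U \<subseteq> topspace X \<and> (\<exists>V. openin X V \<and> y \<in> V \<and> V \<subseteq> U)"

definition jointly_intermittently_uniformly_recurrent ::
    "'a::semigroup_mult filter \<Rightarrow> 'b topology \<Rightarrow> ('a \<Rightarrow> 'b \<Rightarrow> 'b) \<Rightarrow> 'b \<Rightarrow> 'b \<Rightarrow> bool" where
  "jointly_intermittently_uniformly_recurrent F X T x y \<longleftrightarrow>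
     (\<forall>U. neighbourhood_in X y U \<longrightarrow> piecewise_syndetic F {s. T s x \<in> U \<and> T s y \<in> U})"

end

theory Submission
  imports Defs
begin

text \<open>
  A closed subset of \<open>\<beta>S\<close> is the set of ultrafilters below a library filter, so compactness only
  means that every proper filter has an ultrafilter below it.

  A set is piecewise \<open>F\<close>-syndetic iff it belongs to a member of the smallest ideal \<open>K\<close>.  Hence, for a
  jointly intermittently uniformly recurrent pair \<open>(x, y)\<close>, the ultrafilters in the closure of \<open>K\<close>
  along which both \<open>T\<^sub>s x\<close> and \<open>T\<^sub>s y\<close> tend to \<open>y\<close> form a nonempty closed set.  It is a subsemigroup,
  because the closure of \<open>K\<close> is a right ideal and the maps \<open>T\<^sub>s\<close> are continuous, and any idempotent in it
  witnesses quasi-centrality.  Conversely, for an idempotent \<open>p\<close> in the closure of \<open>K\<close> with \<open>A \<in> p\<close>, take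
  the shift on 0-1 functions on \<open>S \<union> {e}\<close>, the indicator function \<open>x\<close> of \<open>A\<close>, the limit \<open>y\<close> of
  \<open>T\<^sub>s x\<close> along \<open>p\<close>, and \<open>U = {f. f e = 1}\<close>.
\<close>

section \<open>Ultrafilters\<close>

lemma mem_sets_of: "A \<in> sets_of F \<longleftrightarrow> eventually (\<lambda>s. s \<in> A) F"
  by (simp add: sets_of_def)

lemma le_filter_iff_sets_of: "p \<le> F \<longleftrightarrow> sets_of F \<subseteq> sets_of p"
proof
  assume "sets_of F \<subseteq> sets_of p"
  then have "eventually P p" if "eventually P F" for P
    using that subsetD[of "sets_of F" "sets_of p" "{s. P s}"] by (simp add: sets_of_def)
  then show "p \<le> F"
    by (rule filter_leI)
qed (auto simp: sets_of_def le_filter_def)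

lemma mem_hull_of: "p \<in> hull_of F \<longleftrightarrow> p \<in> ultrafilters \<and> p \<le> F"
  by (simp add: hull_of_def le_filter_iff_sets_of)

text \<open>Phrased as commutation with negation, so that products of ultrafilters can be handled by
  rewriting alone.\<close>

lemma mem_ultrafilters:
  "p \<in> ultrafilters \<longleftrightarrow> (\<forall>P. eventually (\<lambda>x. \<not> P x) p \<longleftrightarrow> \<not> eventually P p)"
proof
  assume p: "p \<in> ultrafilters"
  show "\<forall>P. eventually (\<lambda>x. \<not> P x) p \<longleftrightarrow> \<not> eventually P p"
  proof (intro allI iffI)
    fix P
    assume "eventually (\<lambda>x. \<not> P x) p"
    then show "\<not> eventually P p"
      using p eventually_conj[of "\<lambda>x. \<not> P x" p P] by (auto simp: ultrafilters_def trivial_limit_def)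
  next
    fix P
    assume "\<not> eventually P p"
    then show "eventually (\<lambda>x. \<not> P x) p"
      using p by (auto simp: ultrafilters_def sets_of_def dest!: spec[of _ "{x. P x}"])
  qed
next
  assume *: "\<forall>P. eventually (\<lambda>x. \<not> P x) p \<longleftrightarrow> \<not> eventually P p"
  then have "p \<noteq> bot"
    by (metis eventually_bot)
  with * show "p \<in> ultrafilters"
    by (auto simp: ultrafilters_def sets_of_def)
qed

lemma ultrafilter_not: "p \<in> ultrafilters \<Longrightarrow> eventually (\<lambda>x. \<not> P x) p \<longleftrightarrow> \<not> eventually P p"
  by (simp add: mem_ultrafilters)

lemma ultrafilter_not_bot: "p \<in> ultrafilters \<Longrightarrow> p \<noteq> bot"
  by (simp add: ultrafilters_def)

lemma ultrafilter_le_imp_eq: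
  assumes "p \<in> ultrafilters" "q \<in> ultrafilters" "p \<le> q"
  shows "p = q"
proof (rule antisym[OF \<open>p \<le> q\<close>], rule filter_leI)
  fix P
  assume "eventually P p"
  then show "eventually P q"
    using assms by (metis filter_leD ultrafilter_not)
qed

section \<open>Zorn's lemma and compactness\<close>

text \<open>A nonempty finite subset of a chain contains its own infimum, so finite infima stay
  proper, and properness of an infimum of filters depends only on these.\<close>

lemma Inf_chain_not_bot:
  assumes "bot \<notin> \<C>" "\<And>G H. G \<in> \<C> \<Longrightarrow> H \<in> \<C> \<Longrightarrow> G \<le> H \<or> H \<le> G"
  shows "Inf \<C> \<noteq> (bot :: 'a filter)"
proof (rule Inf_filter_not_bot)
  fix X
  assume "X \<subseteq> \<C>" "finite X"
  show "Inf X \<noteq> bot"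
  proof (cases "X = {}")
    case False
    with \<open>finite X\<close> have "Inf X \<in> X"
      using \<open>X \<subseteq> \<C>\<close>
    proof (induction X rule: finite_ne_induct)
      case (insert G X)
      then have "G \<le> Inf X \<or> Inf X \<le> G"
        using assms(2)[of G "Inf X"] by auto
      with insert show ?case
        by (auto simp: inf_absorb1 inf_absorb2)
    qed auto
    with \<open>X \<subseteq> \<C>\<close> assms(1) show ?thesis
      by auto
  qed (simp add: trivial_limit_def)
qed

text \<open>Zorn's lemma in the reversed order, with infima as lower bounds of chains. The choice of
  \<open>P\<close> yields ultrafilters, minimal closed subsemigroups or minimal closed left
  ideals.\<close>

lemma minimal_filter:
  fixes G0 :: "'a filter"
  assumes "G0 \<noteq> bot" "P G0"
    and Inf: "\<And>\<C>. \<C> \<noteq> {} \<Longrightarrow> (\<And>G. G \<in> \<C> \<Longrightarrow> P G) \<Longrightarrow> P (Inf \<C>)"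
  obtains G where "G \<noteq> bot" "G \<le> G0" "P G" "\<And>H. H \<noteq> bot \<Longrightarrow> H \<le> G \<Longrightarrow> P H \<Longrightarrow> H = G"
proof -
  let ?A = "{G. G \<noteq> bot \<and> G \<le> G0 \<and> P G}"
  have "\<exists>m\<in>?A. \<forall>a\<in>?A. m \<ge> a \<longrightarrow> a = m"
  proof (rule predicate_Zorn)
    show "partial_order_on ?A (relation_of (\<ge>) ?A)"
      by (rule partial_order_on_relation_ofI) auto
    fix \<C>
    assume "\<C> \<in> Chains (relation_of (\<ge>) ?A)"
    then have sub: "\<C> \<subseteq> ?A" and lin: "\<And>G H. G \<in> \<C> \<Longrightarrow> H \<in> \<C> \<Longrightarrow> G \<le> H \<or> H \<le> G"
      by (auto simp: Chains_def relation_of_def)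
    show "\<exists>u\<in>?A. \<forall>a\<in>\<C>. a \<ge> u"
    proof (cases "\<C> = {}")
      case True
      with assms show ?thesis by auto
    next
      case False
      moreover have "bot \<notin> \<C>"
        using sub by auto
      ultimately have "Inf \<C> \<in> ?A"
        using sub Inf_chain_not_bot[of \<C>] lin Inf[of \<C>] by (auto intro: Inf_lower2)
      then show ?thesis
        by (blast intro: Inf_lower)
    qed
  qed
  then obtain m where m: "m \<in> ?A" "\<And>a. a \<in> ?A \<Longrightarrow> a \<le> m \<Longrightarrow> a = m"
    by blast
  show thesis
  proof (rule that)
    fix H
    assume "H \<noteq> bot" "H \<le> m" "P H"
    with m show "H = m"
      by (metis (mono_tags, lifting) mem_Collect_eq order_trans)
  qed (use m in auto)
qed

text \<open>Adding \<open>A\<close> to a minimal proper filter \<open>p\<close> either makes it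
  improper, so that \<open>- A\<close> belongs to \<open>p\<close>, or changes nothing, so that
  \<open>A\<close> does.\<close>

lemma ultrafilter_below:
  assumes "F \<noteq> bot"
  obtains p where "p \<in> hull_of F"
proof -
  obtain p where p: "p \<noteq> bot" "p \<le> F" and min: "\<And>H. H \<noteq> bot \<Longrightarrow> H \<le> p \<Longrightarrow> H = p"
    using minimal_filter[of F "\<lambda>_. True"] assms by auto
  have "A \<in> sets_of p \<or> - A \<in> sets_of p" for A
  proof (cases "inf p (principal A) = bot")
    case True
    then have "eventually (\<lambda>s. s \<in> - A) p"
      by (simp add: trivial_limit_def eventually_inf_principal)
    then show ?thesis
      by (simp add: mem_sets_of)
  next
    case False
    then have "inf p (principal A) = p"
      by (rule min) simp
    then have "eventually (\<lambda>s. s \<in> A) p"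
      by (metis inf.cobounded2 le_principal)
    then show ?thesis
      by (simp add: mem_sets_of)
  qed
  with p show thesis
    by (intro that) (auto simp: mem_hull_of ultrafilters_def)
qed

text \<open>Compactness of \<open>hull_of G\<close>: were \<open>G\<close> compatible with the
  failure of every \<open>Q g\<close>, an ultrafilter below both would escape the cover.\<close>

lemma hull_of_finite_subcover:
  assumes "\<And>r. r \<in> hull_of G \<Longrightarrow> \<exists>g\<in>V. eventually (Q g) r"
  obtains X where "X \<subseteq> V" "finite X" "eventually (\<lambda>x. \<exists>g\<in>X. Q g x) G"
proof -
  let ?N = "\<lambda>X. INF g\<in>X. principal {x. \<not> Q g x}"
  have "inf G (?N V) = bot"
  proof (rule ccontr)
    assume "inf G (?N V) \<noteq> bot"
    then obtain r where r: "r \<in> ultrafilters" "r \<le> G" "r \<le> ?N V"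
      by (rule ultrafilter_below) (auto simp: mem_hull_of)
    then obtain g where g: "g \<in> V" "eventually (Q g) r"
      using assms by (auto simp: mem_hull_of)
    have "r \<le> principal {x. \<not> Q g x}"
      using r(3) g(1) by (rule order_trans[OF _ INF_lower])
    then show False
      using g(2) r(1) by (simp add: le_principal ultrafilter_not)
  qed
  then obtain P R where PR: "eventually P G" "eventually R (?N V)" "\<And>x. P x \<and> R x \<Longrightarrow> False"
    by (auto simp: trivial_limit_def eventually_inf)
  \<comment> \<open>An event of an infimum of filters is already an event of a finite subinfimum;
    this supplies the finite subcover.\<close>
  then obtain X where X: "X \<subseteq> V" "finite X" "eventually R (?N X)"
    using eventually_INF[of R "\<lambda>g. principal {x. \<not> Q g x}" V] by auto
  have R: "R x" if "\<forall>g\<in>X. \<not> Q g x" for x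
    using X that by (auto simp: INF_principal_finite eventually_principal)
  have "eventually (\<lambda>x. \<exists>g\<in>X. Q g x) G"
    using PR(1) by (rule eventually_mono) (use PR(3) R in blast)
  with X show thesis
    by (intro that)
qed

section \<open>The product of filters\<close>

lemma eventually_filter_mult:
  "eventually P (p \<odot> q) \<longleftrightarrow> eventually (\<lambda>x. eventually (\<lambda>y. P (x * y)) q) p"
  using mem_filter_mult_iff[of "{s. P s}" p q] by (simp add: sets_of_def inv_translate_def)

lemma filter_mult_assoc: "(p \<odot> q) \<odot> r = p \<odot> (q \<odot> r)"
  by (simp add: filter_eq_iff eventually_filter_mult mult.assoc)

lemma filter_mult_mono: "p \<le> p' \<Longrightarrow> q \<le> q' \<Longrightarrow> p \<odot> q \<le> p' \<odot> q'"
  by (auto simp: le_filter_def eventually_filter_mult elim!: eventually_mono)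

lemma filter_mult_ultrafilter:
  "p \<in> ultrafilters \<Longrightarrow> q \<in> ultrafilters \<Longrightarrow> p \<odot> q \<in> ultrafilters"
  by (simp add: mem_ultrafilters eventually_filter_mult)

text \<open>Right multiplication by \<open>q\<close> is continuous, so it maps the closed set \<open>hull_of F\<close> onto the
  closed set \<open>hull_of (F \<odot> q)\<close>, and the fibre over \<open>r\<close> is the hull of a filter.\<close>

definition fibre :: "'a::semigroup_mult filter \<Rightarrow> 'a filter \<Rightarrow> 'a filter" where
  "fibre q r = (INF A\<in>sets_of r. principal {x. eventually (\<lambda>y. x * y \<in> A) q})"

lemma le_fibre_iff:
  assumes "q \<in> ultrafilters" "r \<in> ultrafilters" "p \<in> ultrafilters"
  shows "p \<le> fibre q r \<longleftrightarrow> p \<odot> q = r"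
proof -
  have "p \<le> fibre q r \<longleftrightarrow> p \<odot> q \<le> r"
    by (simp add: fibre_def le_INF_iff le_principal le_filter_iff_sets_of[of "p \<odot> q"] subset_eq
        mem_sets_of[of _ "p \<odot> q"] eventually_filter_mult)
  then show ?thesis
    using assms by (auto intro: ultrafilter_le_imp_eq filter_mult_ultrafilter)
qed

text \<open>It suffices that \<open>F\<close> is compatible with the fibre over \<open>r\<close>. If
  not, some \<open>A\<close> in \<open>r\<close> has \<open>x * y\<close> outside \<open>A\<close>
  for \<open>F\<close>-many \<open>x\<close> and \<open>q\<close>-many \<open>y\<close>; then
  \<open>- A\<close> belongs to \<open>F \<odot> q\<close>, hence to \<open>r\<close>.\<close>

lemma hull_of_filter_multE:
  assumes q: "q \<in> ultrafilters" and r: "r \<in> hull_of (F \<odot> q)"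
  obtains p where "p \<in> hull_of F" "r = p \<odot> q"
proof -
  have ru: "r \<in> ultrafilters" and rle: "r \<le> F \<odot> q"
    using r by (auto simp: mem_hull_of)
  let ?B = "\<lambda>A. {x. eventually (\<lambda>y. x * y \<in> A) q}"
  \<comment> \<open>The sets \<open>?B A\<close> are closed under binary intersection, so a single
    \<open>A\<close> witnesses each event.\<close>
  have fib: "eventually P (fibre q r) \<longleftrightarrow> (\<exists>A\<in>sets_of r. ?B A \<subseteq> {x. P x})" for P
    unfolding fibre_def
  proof (subst eventually_INF_base)
    show "sets_of r \<noteq> {}"
      by (auto simp: sets_of_def intro!: exI[of _ UNIV])
    fix A B
    assume "A \<in> sets_of r" "B \<in> sets_of r"
    then show "\<exists>x\<in>sets_of r. principal (?B x) \<le> inf (principal (?B A)) (principal (?B B))"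
      by (intro bexI[of _ "A \<inter> B"]) (auto simp: sets_of_def eventually_conj_iff)
  qed (auto simp: eventually_principal)
  have "inf F (fibre q r) \<noteq> bot"
  proof
    assume "inf F (fibre q r) = bot"
    then obtain P R where PR: "eventually P F" "eventually R (fibre q r)" "\<And>x. P x \<and> R x \<Longrightarrow> False"
      by (auto simp: trivial_limit_def eventually_inf)
    then obtain A where A: "A \<in> sets_of r" "?B A \<subseteq> {x. R x}"
      by (auto simp: fib)
    have "eventually (\<lambda>x. eventually (\<lambda>y. \<not> x * y \<in> A) q) F"
      using PR(1) by (rule eventually_mono) (use PR(3) A(2) in \<open>auto simp: ultrafilter_not[OF q]\<close>)
    then have "eventually (\<lambda>y. y \<notin> A) r"
      using rle by (simp add: le_filter_def eventually_filter_mult)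
    with A(1) show False
      by (simp add: mem_sets_of ultrafilter_not[OF ru])
  qed
  then obtain p where "p \<in> ultrafilters" "p \<le> F" "p \<le> fibre q r"
    by (rule ultrafilter_below) (auto simp: mem_hull_of)
  then show thesis
    using that[of p] le_fibre_iff[OF q ru] by (auto simp: mem_hull_of)
qed

lemma hull_of_filter_mult:
  assumes "q \<in> ultrafilters"
  shows "hull_of (F \<odot> q) = (\<lambda>p. p \<odot> q) ` hull_of F"
proof
  show "(\<lambda>p. p \<odot> q) ` hull_of F \<subseteq> hull_of (F \<odot> q)"
    using assms by (auto simp: mem_hull_of intro: filter_mult_ultrafilter filter_mult_mono)
qed (use assms in \<open>auto elim: hull_of_filter_multE\<close>)

lemma hull_of_mono: "G \<le> H \<Longrightarrow> hull_of G \<subseteq> hull_of H"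
  by (auto simp: mem_hull_of)

text \<open>A filter is the intersection of the ultrafilters below it, so minimality of closed sets
  can be argued with filters.\<close>

lemma le_iff_hull_of_subset: "G \<le> H \<longleftrightarrow> hull_of G \<subseteq> hull_of H"
proof
  assume sub: "hull_of G \<subseteq> hull_of H"
  show "G \<le> H"
  proof (rule filter_leI)
    fix P
    assume P: "eventually P H"
    have "inf G (principal {x. \<not> P x}) = bot"
    proof (rule ccontr)
      assume "inf G (principal {x. \<not> P x}) \<noteq> bot"
      then obtain r where "r \<in> ultrafilters" "r \<le> G" "r \<le> principal {x. \<not> P x}"
        by (rule ultrafilter_below) (auto simp: mem_hull_of)
      moreover from this have "eventually P r"
        using sub P filter_leD[of r H P] by (auto simp: mem_hull_of)
      ultimately show False
        by (simp add: le_principal ultrafilter_not)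
    qed
    then show "eventually P G"
      by (simp add: trivial_limit_def eventually_inf_principal)
  qed
qed (rule hull_of_mono)

lemma hull_of_Inf: "\<C> \<noteq> {} \<Longrightarrow> hull_of (Inf \<C>) = (\<Inter>G\<in>\<C>. hull_of G)"
  by (auto simp: mem_hull_of le_Inf_iff)

section \<open>Idempotents in closed subsemigroups\<close>

definition mult_closed :: "'a::semigroup_mult filter set \<Rightarrow> bool" where
  "mult_closed H \<longleftrightarrow> (\<forall>p\<in>H. \<forall>q\<in>H. p \<odot> q \<in> H)"

text \<open>The Ellis--Numakura lemma, for the closed subsemigroup \<open>hull_of F\<close> of \<open>\<beta>S\<close>.\<close>

lemma idempotent_exists:
  assumes "F \<noteq> bot" "mult_closed (hull_of F)"
  obtains p where "p \<in> hull_of F" "p \<odot> p = p"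
proof -
  obtain G where G: "G \<noteq> bot" "G \<le> F" "mult_closed (hull_of G)"
    and min: "\<And>H. H \<noteq> bot \<Longrightarrow> H \<le> G \<Longrightarrow> mult_closed (hull_of H) \<Longrightarrow> H = G"
    by (rule minimal_filter[of F "\<lambda>G. mult_closed (hull_of G)"])
      (use assms in \<open>auto simp: hull_of_Inf mult_closed_def\<close>)
  obtain q where q: "q \<in> hull_of G"
    using G(1) by (rule ultrafilter_below)
  then have qu: "q \<in> ultrafilters"
    by (simp add: mem_hull_of)
  \<comment> \<open>The products with right factor \<open>q\<close> form a closed subsemigroup
    inside \<open>hull_of G\<close>, which is minimal.\<close>
  have "G \<odot> q = G"
  proof (rule min)
    have "q \<odot> q \<in> hull_of (G \<odot> q)"
      using q qu by (simp add: hull_of_filter_mult)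
    then show "G \<odot> q \<noteq> bot"
      using ultrafilter_not_bot[of "q \<odot> q"] by (auto simp: mem_hull_of bot_unique)
    show "G \<odot> q \<le> G"
      using G(3) q qu by (auto simp: le_iff_hull_of_subset hull_of_filter_mult mult_closed_def)
    show "mult_closed (hull_of (G \<odot> q))"
      using G(3) q qu
      by (auto simp: hull_of_filter_mult mult_closed_def simp flip: filter_mult_assoc)
  qed
  then have "q \<in> (\<lambda>p. p \<odot> q) ` hull_of G"
    using q hull_of_filter_mult[OF qu, of G] by simp
  then obtain p where p: "p \<in> hull_of G" "p \<odot> q = q"
    by force
  \<comment> \<open>This filter encodes the solutions of \<open>p \<odot> q = q\<close>, a nonempty
    closed subsemigroup; by minimality \<open>q\<close> itself is a solution.\<close>
  let ?N = "inf G (fibre q q)"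
  have N: "hull_of ?N = {p \<in> hull_of G. p \<odot> q = q}"
    using qu by (auto simp: mem_hull_of le_fibre_iff)
  have "?N = G"
  proof (rule min)
    show "?N \<noteq> bot"
      using p N ultrafilter_not_bot[of p] by (auto simp: mem_hull_of bot_unique)
    show "mult_closed (hull_of ?N)"
      using G(3) unfolding N by (auto simp: mult_closed_def filter_mult_assoc)
  qed simp
  then have "q \<odot> q = q"
    using q N by auto
  then show thesis
    using that[of q] q G(2) hull_of_mono by blast
qed

section \<open>The smallest ideal\<close>

text \<open>For a semigroup \<open>H\<close> this is the union of its minimal left ideals:
  \<open>p\<close> lies in \<open>H q p\<close> for every \<open>q\<close>, so \<open>H p\<close>
  contains \<open>p\<close> and no smaller left ideal.\<close>

definition ideal_kernel :: "'a::semigroup_mult filter set \<Rightarrow> 'a filter set" where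
  "ideal_kernel H = {p \<in> H. \<forall>q\<in>H. \<exists>u\<in>H. p = u \<odot> (q \<odot> p)}"

text \<open>Any \<open>p\<close> in a minimal closed left ideal \<open>hull_of G\<close> works: the
  products with right factor \<open>q \<odot> p\<close> form a closed left ideal inside it, hence
  all of it, and so include \<open>p\<close>.\<close>

lemma kernel_not_empty:
  assumes F: "F \<noteq> bot" "mult_closed (hull_of F)"
  shows "ideal_kernel (hull_of F) \<noteq> {}"
proof -
  let ?P = "\<lambda>G. \<forall>p\<in>hull_of F. \<forall>q\<in>hull_of G. p \<odot> q \<in> hull_of G"
  obtain G where G: "G \<noteq> bot" "G \<le> F" "?P G"
    and min: "\<And>H. H \<noteq> bot \<Longrightarrow> H \<le> G \<Longrightarrow> ?P H \<Longrightarrow> H = G"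
    by (rule minimal_filter[of F ?P]) (use F in \<open>auto simp: hull_of_Inf mult_closed_def\<close>)
  obtain p where p: "p \<in> hull_of G"
    using G(1) by (rule ultrafilter_below)
  have pF: "p \<in> hull_of F"
    using p G(2) hull_of_mono by blast
  have "\<exists>u\<in>hull_of F. p = u \<odot> (q \<odot> p)" if q: "q \<in> hull_of F" for q
  proof -
    let ?r = "q \<odot> p"
    have r: "?r \<in> hull_of G"
      using q p G(3) by blast
    then have ru: "?r \<in> ultrafilters"
      by (simp add: mem_hull_of)
    have "F \<odot> ?r = G"
    proof (rule min)
      have "p \<odot> ?r \<in> hull_of (F \<odot> ?r)"
        using pF ru by (simp add: hull_of_filter_mult)
      then show "F \<odot> ?r \<noteq> bot"
        using ultrafilter_not_bot[of "p \<odot> ?r"] by (auto simp: mem_hull_of bot_unique)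
      show "F \<odot> ?r \<le> G"
        unfolding le_iff_hull_of_subset hull_of_filter_mult[OF ru] using G(3) r by auto
      show "?P (F \<odot> ?r)"
        unfolding hull_of_filter_mult[OF ru] using F(2)
        by (auto simp: mult_closed_def simp flip: filter_mult_assoc)
    qed
    then show ?thesis
      using p hull_of_filter_mult[OF ru, of F] by auto
  qed
  with pF show ?thesis
    by (auto simp: ideal_kernel_def)
qed

text \<open>For \<open>q \<odot> p\<close>, the defining equation of \<open>p\<close> at
  \<open>r \<odot> q\<close> is multiplied by \<open>q\<close> on the left; for
  \<open>p \<odot> q\<close>, the equation at \<open>r\<close> is multiplied by \<open>q\<close> on
  the right.\<close>

lemma kernel_mult:
  assumes H: "mult_closed H" and p: "p \<in> ideal_kernel H" and q: "q \<in> H"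
  shows "q \<odot> p \<in> ideal_kernel H" "p \<odot> q \<in> ideal_kernel H"
proof -
  have pH: "p \<in> H" and ker: "\<And>r. r \<in> H \<Longrightarrow> \<exists>u\<in>H. p = u \<odot> (r \<odot> p)"
    using p by (auto simp: ideal_kernel_def)
  have HH: "\<And>r s. r \<in> H \<Longrightarrow> s \<in> H \<Longrightarrow> r \<odot> s \<in> H"
    using H by (auto simp: mult_closed_def)
  have "\<exists>u\<in>H. q \<odot> p = u \<odot> (r \<odot> (q \<odot> p))" if r: "r \<in> H" for r
  proof -
    obtain u where "u \<in> H" "p = u \<odot> ((r \<odot> q) \<odot> p)"
      using ker HH r q by blast
    then show ?thesis
      using HH q by (intro bexI[of _ "q \<odot> u"]) (simp_all add: filter_mult_assoc)
  qed
  then show "q \<odot> p \<in> ideal_kernel H"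
    using HH pH q by (simp add: ideal_kernel_def)
  have "\<exists>u\<in>H. p \<odot> q = u \<odot> (r \<odot> (p \<odot> q))" if r: "r \<in> H" for r
  proof -
    obtain u where "u \<in> H" "p = u \<odot> (r \<odot> p)"
      using ker r by blast
    then show ?thesis
      by (metis filter_mult_assoc)
  qed
  then show "p \<odot> q \<in> ideal_kernel H"
    using HH pH q by (simp add: ideal_kernel_def)
qed

text \<open>The kernel is an ideal, and for \<open>i\<close> in any ideal \<open>I\<close> the
  equation \<open>p = u \<odot> (i \<odot> p)\<close> puts each kernel element \<open>p\<close> into
  \<open>I\<close>.\<close>

lemma smallest_ideal_eq_kernel:
  assumes "F \<noteq> bot" "mult_closed (hull_of F)"
  shows "smallest_ideal (hull_of F) = ideal_kernel (hull_of F)"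
  unfolding smallest_ideal_def
proof (rule Least_equality)
  show "two_sided_ideal (hull_of F) (ideal_kernel (hull_of F))"
    unfolding two_sided_ideal_def
  proof (intro conjI ballI)
    show "ideal_kernel (hull_of F) \<subseteq> hull_of F"
      by (auto simp: ideal_kernel_def)
  qed (use assms kernel_not_empty kernel_mult in blast)+
next
  fix I
  assume I: "two_sided_ideal (hull_of F) I"
  then obtain i where i: "i \<in> I" "i \<in> hull_of F"
    by (auto simp: two_sided_ideal_def)
  show "ideal_kernel (hull_of F) \<subseteq> I"
  proof
    fix p
    assume "p \<in> ideal_kernel (hull_of F)"
    then obtain u where "p \<in> hull_of F" "u \<in> hull_of F" "p = u \<odot> (i \<odot> p)"
      using i by (auto simp: ideal_kernel_def)
    then show "p \<in> I"
      using I i by (metis two_sided_ideal_def)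
  qed
qed

section \<open>Closures in the space of ultrafilters\<close>

lemma topspace_beta: "topspace beta = ultrafilters"
  by (auto simp: beta_def basic_clopen_def sets_of_def intro!: exI[of _ UNIV])

lemma openin_beta_basic:
  assumes "openin beta T" "p \<in> T"
  shows "\<exists>A. p \<in> basic_clopen A \<and> basic_clopen A \<subseteq> T"
proof -
  have "generate_topology_on (range basic_clopen) T"
    using assms(1) unfolding beta_def by (rule openin_topology_generated_by)
  then show ?thesis
    using assms(2)
  proof (induction arbitrary: p)
    case (Int a b)
    then obtain A B where "p \<in> basic_clopen A" "basic_clopen A \<subseteq> a"
      "p \<in> basic_clopen B" "basic_clopen B \<subseteq> b"
      by blast
    moreover have "basic_clopen (A \<inter> B) = basic_clopen A \<inter> basic_clopen B" for A B :: "'a set"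
      by (auto simp: basic_clopen_def sets_of_def eventually_conj_iff)
    ultimately show ?case
      by (intro exI[of _ "A \<inter> B"]) auto
  next
    case (UN K)
    then show ?case
      by (metis UnionE Union_upper order_trans)
  qed auto
qed

lemma beta_closure_of:
  "p \<in> beta closure_of Z \<longleftrightarrow> p \<in> ultrafilters \<and> (\<forall>A\<in>sets_of p. \<exists>r\<in>Z \<inter> ultrafilters. A \<in> sets_of r)"
  (is "?L \<longleftrightarrow> ?R")
proof
  assume ?L
  then have p: "p \<in> ultrafilters" and Z: "\<And>T. p \<in> T \<Longrightarrow> openin beta T \<Longrightarrow> \<exists>r\<in>Z. r \<in> T"
    by (auto simp: in_closure_of topspace_beta)
  have "openin beta (basic_clopen A)" for A :: "'a set"
    unfolding beta_def by (rule topology_generated_by_Basis) simp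
  then have "\<exists>r\<in>Z. r \<in> basic_clopen A" if "A \<in> sets_of p" for A
    using Z[of "basic_clopen A"] p that by (simp add: basic_clopen_def)
  with p show ?R
    by (auto simp: basic_clopen_def)
next
  assume R: ?R
  show ?L
    unfolding in_closure_of topspace_beta
  proof (intro conjI allI impI)
    fix T
    assume "p \<in> T \<and> openin beta T"
    then obtain A where "p \<in> basic_clopen A" "basic_clopen A \<subseteq> T"
      using openin_beta_basic by blast
    with R show "\<exists>y. y \<in> Z \<and> y \<in> T"
      by (force simp: basic_clopen_def)
  qed (use R in blast)
qed

text \<open>In the order of filters, \<open>Sup\<close> is intersection of the families of members.
  An ultrafilter contains the intersection of the filters in \<open>Z\<close> iff each of its
  members belongs to some filter in \<open>Z\<close>, which is adherence to
  \<open>Z\<close>.\<close>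

lemma closure_of_kernel:
  "beta closure_of ideal_kernel (hull_of F) = hull_of (Sup (ideal_kernel (hull_of F)))"
proof -
  have K: "ideal_kernel (hull_of F) \<inter> ultrafilters = ideal_kernel (hull_of F)"
    by (auto simp: ideal_kernel_def mem_hull_of)
  have "p \<le> Sup Z \<longleftrightarrow> (\<forall>A\<in>sets_of p. \<exists>r\<in>Z. A \<in> sets_of r)"
    if p: "p \<in> ultrafilters" and Z: "Z \<subseteq> ultrafilters" for p :: "'a filter" and Z
  proof -
    have "p \<le> Sup Z \<longleftrightarrow> (\<forall>P. (\<forall>r\<in>Z. eventually P r) \<longrightarrow> eventually P p)"
      by (simp add: le_filter_def eventually_Sup)
    \<comment> \<open>Complementation exchanges the two sides, as \<open>p\<close> and all elements
      of \<open>Z\<close> are ultrafilters.\<close>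
    also have "\<dots> \<longleftrightarrow> (\<forall>P. eventually P p \<longrightarrow> (\<exists>r\<in>Z. eventually P r))"
      (is "(\<forall>P. ?Q P) \<longleftrightarrow> (\<forall>P. ?R P)")
    proof -
      have "?Q (\<lambda>x. \<not> P x) \<longleftrightarrow> ?R P" for P
        using p Z by (auto simp: ultrafilter_not subset_eq)
      moreover have "?R (\<lambda>x. \<not> P x) \<longleftrightarrow> ?Q P" for P
        using p Z by (auto simp: ultrafilter_not subset_eq)
      ultimately show ?thesis
        by blast
    qed
    also have "\<dots> \<longleftrightarrow> (\<forall>A\<in>sets_of p. \<exists>r\<in>Z. A \<in> sets_of r)"
    proof (intro iffI allI ballI impI)
      fix P
      assume "\<forall>A\<in>sets_of p. \<exists>r\<in>Z. A \<in> sets_of r" "eventually P p"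
      then show "\<exists>r\<in>Z. eventually P r"
        by (auto simp: sets_of_def dest!: spec[of _ "{x. P x}"])
    qed (auto simp: sets_of_def)
    finally show ?thesis .
  qed
  moreover have "ideal_kernel (hull_of F) \<subseteq> ultrafilters"
    using K by blast
  ultimately show ?thesis
    by (auto simp: beta_closure_of mem_hull_of K)
qed

section \<open>Piecewise syndetic sets\<close>

text \<open>For \<open>r = q \<odot> p\<close> the kernel property gives
  \<open>p = u \<odot> r\<close>, and \<open>V\<close> belongs to \<open>u\<close>, so some
  \<open>g\<close> in \<open>V\<close> has its inverse translate of \<open>A\<close> in
  \<open>r\<close>. Compactness makes finitely many \<open>g\<close> serve all such
  \<open>r\<close>. Every set of the resulting family then belongs to \<open>p\<close>.\<close>

lemma piecewise_syndetic_if_kernel: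
  assumes p: "p \<in> ideal_kernel (hull_of F)" and A: "eventually (\<lambda>s. s \<in> A) p"
  shows "piecewise_syndetic F A"
proof -
  have pu: "p \<in> ultrafilters" and ple: "p \<le> F"
    using p by (auto simp: ideal_kernel_def mem_hull_of)
  have "\<exists>X. finite X \<and> X \<subseteq> V \<and> eventually (\<lambda>x. eventually (\<lambda>y. \<exists>g\<in>X. g * (x * y) \<in> A) p) F"
    if V: "V \<in> sets_of F" for V
  proof -
    have "\<exists>g\<in>V. eventually (\<lambda>y. g * y \<in> A) r" if r: "r \<in> hull_of (F \<odot> p)" for r
    proof -
      obtain q where "q \<in> hull_of F" "r = q \<odot> p"
        using pu r by (rule hull_of_filter_multE)
      then obtain u where u: "u \<in> hull_of F" "p = u \<odot> r"
        using p by (auto simp: ideal_kernel_def)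
      have "eventually (\<lambda>x. eventually (\<lambda>y. x * y \<in> A) r) u"
        using A unfolding u(2) by (rule eventually_filter_mult[THEN iffD1])
      moreover have "eventually (\<lambda>x. x \<in> V) u"
        using V u(1) by (auto simp: mem_hull_of mem_sets_of le_filter_def)
      moreover have "u \<noteq> bot"
        using u(1) by (auto simp: mem_hull_of ultrafilter_not_bot)
      ultimately show ?thesis
        by (metis (mono_tags, lifting) eventually_conj eventually_happens)
    qed
    then obtain X where "X \<subseteq> V" "finite X" "eventually (\<lambda>y. \<exists>g\<in>X. g * y \<in> A) (F \<odot> p)"
      by (rule hull_of_finite_subcover)
    then show ?thesis
      by (auto simp: eventually_filter_mult)
  qed
  then have "\<exists>G. \<forall>V\<in>sets_of F. finite (G V) \<and> G V \<subseteq> V \<and>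
      eventually (\<lambda>x. eventually (\<lambda>y. \<exists>g\<in>G V. g * (x * y) \<in> A) p) F"
    by (intro bchoice) blast
  then obtain G where G: "\<And>V. V \<in> sets_of F \<Longrightarrow> finite (G V) \<and> G V \<subseteq> V \<and>
      eventually (\<lambda>x. eventually (\<lambda>y. \<exists>g\<in>G V. g * (x * y) \<in> A) p) F"
    by blast
  \<comment> \<open>The \<open>x\<close> for which the corresponding set belongs to
    \<open>p\<close>; the finite subcover says exactly that they form a member of
    \<open>F\<close>.\<close>
  define W where "W V = {x. eventually (\<lambda>y. \<exists>g\<in>G V. g * (x * y) \<in> A) p}" for V
  let ?\<C> = "{inv_translate x (inv_translates (G V) A) \<inter> V | V x. V \<in> sets_of F \<and> x \<in> W V}"
  have "\<forall>C\<in>?\<C>. eventually (\<lambda>s. s \<in> C) p"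
    using ple by (auto simp: W_def inv_translate_def inv_translates_def eventually_conj_iff mem_sets_of
        le_filter_def)
  then have "\<Inter>\<D> \<noteq> {}" if "finite \<D>" "\<D> \<subseteq> ?\<C>" for \<D>
  proof -
    have "eventually (\<lambda>s. \<forall>C\<in>\<D>. s \<in> C) p"
      using that \<open>\<forall>C\<in>?\<C>. eventually (\<lambda>s. s \<in> C) p\<close> by (intro eventually_ball_finite) blast+
    then obtain s where "\<forall>C\<in>\<D>. s \<in> C"
      using eventually_happens[of _ p] ultrafilter_not_bot[OF pu] by (auto simp: trivial_limit_def)
    then show ?thesis
      by blast
  qed
  then have "has_fip ?\<C>"
    by (simp add: has_fip_def)
  moreover have "\<forall>V\<in>sets_of F. finite (G V) \<and> G V \<subseteq> V \<and> W V \<in> sets_of F"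
    using G by (simp add: W_def mem_sets_of)
  ultimately show ?thesis
    unfolding piecewise_syndetic_def by blast
qed

text \<open>The finite intersection property gives an ultrafilter \<open>q\<close> containing the
  whole family. Multiplying by a kernel element on the left, and then by a suitable
  \<open>u\<close>, moves it into the kernel and makes \<open>A\<close> a member.\<close>

lemma kernel_if_piecewise_syndetic:
  assumes F: "F \<noteq> bot" "mult_closed (hull_of F)" and A: "piecewise_syndetic F A"
  obtains p where "p \<in> ideal_kernel (hull_of F)" "eventually (\<lambda>s. s \<in> A) p"
proof -
  obtain G W where GW: "\<And>V. V \<in> sets_of F \<Longrightarrow> finite (G V) \<and> G V \<subseteq> V \<and> W V \<in> sets_of F"
    and fip: "has_fip {inv_translate x (inv_translates (G V) A) \<inter> V | V x. V \<in> sets_of F \<and> x \<in> W V}"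
    (is "has_fip ?\<C>")
    using A unfolding piecewise_syndetic_def by blast
  have "(INF C\<in>?\<C>. principal C) \<noteq> bot"
  proof (rule INF_filter_not_bot)
    fix \<D>
    assume "\<D> \<subseteq> ?\<C>" "finite \<D>"
    moreover from this have "\<Inter>\<D> \<noteq> {}"
      using fip unfolding has_fip_def by blast
    ultimately show "(INF C\<in>\<D>. principal C) \<noteq> bot"
      by (simp add: INF_principal_finite principal_eq_bot_iff)
  qed
  then obtain q where q: "q \<in> ultrafilters" "q \<le> (INF C\<in>?\<C>. principal C)"
    by (rule ultrafilter_below) (auto simp: mem_hull_of)
  have qC: "eventually (\<lambda>s. s \<in> C) q" if "C \<in> ?\<C>" for C
    using q(2) that by (auto simp: le_INF_iff le_principal)
  have "eventually (\<lambda>y. (\<exists>g\<in>G V. g * (x * y) \<in> A) \<and> y \<in> V) q"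
    if "V \<in> sets_of F" "x \<in> W V" for V x
    using qC[of "inv_translate x (inv_translates (G V) A) \<inter> V"] that
    by (auto simp: inv_translate_def inv_translates_def)
  then have qG: "eventually (\<lambda>y. \<exists>g\<in>G V. g * (x * y) \<in> A) q" and qV: "eventually (\<lambda>y. y \<in> V) q"
    if "V \<in> sets_of F" "x \<in> W V" for V x
    using that by (auto simp: eventually_conj_iff)
  have "q \<in> hull_of F"
  proof -
    \<comment> \<open>Properness of \<open>F\<close> yields some \<open>x\<close> in
      \<open>W V\<close>, and the set of the family for \<open>V\<close> and \<open>x\<close> lies
      in \<open>V\<close>.\<close>
    have "V \<in> sets_of q" if V: "V \<in> sets_of F" for V
    proof -
      have "eventually (\<lambda>x. x \<in> W V) F"
        using GW[OF V] by (simp add: mem_sets_of)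
      then obtain x where "x \<in> W V"
        using F(1) by (auto dest!: eventually_happens)
      then show ?thesis
        using qV V by (simp add: mem_sets_of)
    qed
    then show ?thesis
      using q(1) by (auto simp: hull_of_def)
  qed
  obtain k where k: "k \<in> ideal_kernel (hull_of F)"
    using kernel_not_empty[OF F] by blast
  then have kF: "k \<in> hull_of F"
    by (auto simp: ideal_kernel_def)
  define r where "r = k \<odot> q"
  have rK: "r \<in> ideal_kernel (hull_of F)"
    unfolding r_def using F(2) k \<open>q \<in> hull_of F\<close> by (rule kernel_mult)
  have ru: "r \<in> ultrafilters"
    using rK by (auto simp: ideal_kernel_def mem_hull_of)
  let ?R = "{g. eventually (\<lambda>y. g * y \<in> A) r}"
  have R: "\<exists>g\<in>V. g \<in> ?R" if V: "V \<in> sets_of F" for V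
  proof -
    have "eventually (\<lambda>x. x \<in> W V) k"
      using GW[OF V] kF by (auto simp: mem_sets_of mem_hull_of le_filter_def)
    then have "eventually (\<lambda>x. eventually (\<lambda>y. \<exists>g\<in>G V. g * (x * y) \<in> A) q) k"
      by (rule eventually_mono) (rule qG[OF V])
    then have "eventually (\<lambda>y. \<exists>g\<in>G V. g * y \<in> A) r"
      by (simp add: r_def eventually_filter_mult)
    \<comment> \<open>A finite union in the ultrafilter \<open>r\<close> has one of its parts in
      \<open>r\<close>.\<close>
    then have "\<not> (\<forall>g\<in>G V. eventually (\<lambda>y. g * y \<notin> A) r)"
      using eventually_ball_finite[of "G V" "\<lambda>y g. g * y \<notin> A" r] GW[OF V]
        ultrafilter_not[OF ru, of "\<lambda>y. \<exists>g\<in>G V. g * y \<in> A"] by auto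
    then show ?thesis
      using GW[OF V] by (auto simp: ultrafilter_not[OF ru])
  qed
  \<comment> \<open>\<open>?R\<close> meets every member of \<open>F\<close>, so an ultrafilter
    below \<open>F\<close> contains it.\<close>
  have "inf F (principal ?R) \<noteq> bot"
  proof
    assume "inf F (principal ?R) = bot"
    then have "{g. g \<notin> ?R} \<in> sets_of F"
      by (simp add: trivial_limit_def eventually_inf_principal mem_sets_of)
    then show False
      using R by blast
  qed
  then obtain u where u: "u \<in> ultrafilters" "u \<le> F" "u \<le> principal ?R"
    by (rule ultrafilter_below) (auto simp: mem_hull_of)
  show thesis
  proof (rule that)
    show "u \<odot> r \<in> ideal_kernel (hull_of F)"
      using F(2) rK u by (intro kernel_mult) (auto simp: mem_hull_of)
    show "eventually (\<lambda>s. s \<in> A) (u \<odot> r)"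
      using u(3) by (simp add: le_principal eventually_filter_mult)
  qed
qed

section \<open>Quasi-central sets and dynamical systems\<close>

text \<open>If \<open>P\<close> holds along every kernel element, it holds along
  \<open>r \<odot> q\<close> for each kernel element \<open>r\<close>. So the event that
  \<open>P (x * y)\<close> for \<open>q\<close>-many \<open>y\<close> is common to the kernel and
  passes to \<open>p\<close>.\<close>

lemma mult_closed_hull_Sup_kernel:
  assumes F: "mult_closed (hull_of F)"
  shows "mult_closed (hull_of (Sup (ideal_kernel (hull_of F))))"
  unfolding mult_closed_def
proof (intro ballI)
  let ?K = "ideal_kernel (hull_of F)"
  fix p q
  assume p: "p \<in> hull_of (Sup ?K)" and q: "q \<in> hull_of (Sup ?K)"
  have "Sup ?K \<le> F"
    by (rule Sup_least) (auto simp: ideal_kernel_def mem_hull_of)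
  then have qF: "q \<in> hull_of F"
    using q hull_of_mono by blast
  have "eventually P (p \<odot> q)" if P: "\<forall>r\<in>?K. eventually P r" for P
  proof -
    have "\<forall>r\<in>?K. eventually (\<lambda>x. eventually (\<lambda>y. P (x * y)) q) r"
      using P kernel_mult(2)[OF F _ qF] by (simp flip: eventually_filter_mult)
    then show ?thesis
      using p by (simp add: mem_hull_of le_filter_def eventually_Sup eventually_filter_mult)
  qed
  then have "p \<odot> q \<le> Sup ?K"
    by (simp add: le_filter_def eventually_Sup)
  then show "p \<odot> q \<in> hull_of (Sup ?K)"
    using p q by (simp add: mem_hull_of filter_mult_ultrafilter)
qed

lemma quasi_central_iff:
  assumes "F \<noteq> bot" "mult_closed (hull_of F)"
  shows "quasi_central F A \<longleftrightarrow>
    (\<exists>p\<in>hull_of (Sup (ideal_kernel (hull_of F))). p \<odot> p = p \<and> eventually (\<lambda>s. s \<in> A) p)"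
  using assms by (simp add: quasi_central_def smallest_ideal_eq_kernel closure_of_kernel mem_sets_of)

lemma quasi_central_if_recurrent:
  fixes X :: "'b topology"
  assumes F: "F \<noteq> bot" "mult_closed (hull_of F)"
    and X: "dynamical_system X T" and x: "x \<in> topspace X" and y: "y \<in> topspace X"
    and U: "neighbourhood_in X y U"
    and rec: "jointly_intermittently_uniformly_recurrent F X T x y"
  shows "quasi_central F {s. T s x \<in> U}"
proof -
  let ?K = "ideal_kernel (hull_of F)"
  define B where "B V = {s. T s x \<in> V \<and> T s y \<in> V}" for V
  define \<N> where "\<N> = {V. openin X V \<and> y \<in> V}"
  \<comment> \<open>An ultrafilter is below \<open>N\<close> iff both \<open>T s x\<close> and
    \<open>T s y\<close> tend to \<open>y\<close> along it.\<close>
  define N where "N = (INF V\<in>\<N>. principal (B V))"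
  have N: "eventually P N \<longleftrightarrow> (\<exists>V\<in>\<N>. B V \<subseteq> {s. P s})" for P
    unfolding N_def
  proof (subst eventually_INF_base)
    show "\<N> \<noteq> {}"
      using y by (auto simp: \<N>_def)
    fix V W
    assume "V \<in> \<N>" "W \<in> \<N>"
    then show "\<exists>x\<in>\<N>. principal (B x) \<le> inf (principal (B V)) (principal (B W))"
      by (intro bexI[of _ "V \<inter> W"]) (auto simp: \<N>_def B_def)
  qed (auto simp: eventually_principal)
  \<comment> \<open>Otherwise some \<open>B V\<close> misses an event common to all kernel elements;
    but \<open>B V\<close> is piecewise syndetic, hence belongs to one of them.\<close>
  have "inf (Sup ?K) N \<noteq> bot"
  proof
    assume "inf (Sup ?K) N = bot"
    then obtain P R where PR: "eventually P (Sup ?K)" "eventually R N" "\<And>s. P s \<and> R s \<Longrightarrow> False"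
      by (auto simp: trivial_limit_def eventually_inf)
    then obtain V where V: "V \<in> \<N>" "B V \<subseteq> {s. R s}"
      by (auto simp: N)
    then have "neighbourhood_in X y V"
      by (auto simp: \<N>_def neighbourhood_in_def dest: openin_subset)
    then have "piecewise_syndetic F (B V)"
      using rec by (simp add: jointly_intermittently_uniformly_recurrent_def B_def)
    then obtain p where p: "p \<in> ?K" "eventually (\<lambda>s. s \<in> B V) p"
      using F by (auto elim: kernel_if_piecewise_syndetic)
    have "eventually (\<lambda>s. s \<in> B V \<and> P s) p"
      using p PR(1) by (auto simp: eventually_Sup eventually_conj_iff)
    then have "p = bot"
      using PR(3) V(2) by (auto simp: trivial_limit_def elim!: eventually_mono)
    then show False
      using p(1) ultrafilter_not_bot[of p] by (auto simp: ideal_kernel_def mem_hull_of)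
  qed
  moreover have "mult_closed (hull_of (inf (Sup ?K) N))"
    unfolding mult_closed_def
  proof (intro ballI)
    fix p q
    assume p: "p \<in> hull_of (inf (Sup ?K) N)" and q: "q \<in> hull_of (inf (Sup ?K) N)"
    then have "p \<odot> q \<in> hull_of (Sup ?K)"
      using mult_closed_hull_Sup_kernel[OF F(2)] by (auto simp: mult_closed_def mem_hull_of)
    moreover have "p \<odot> q \<le> N"
      unfolding N_def
    proof (rule INF_greatest)
      fix V
      assume V: "V \<in> \<N>"
      have ev: "eventually (\<lambda>s. s \<in> B W) r" if "r \<in> hull_of (inf (Sup ?K) N)" "W \<in> \<N>" for r W
        using that by (auto simp: mem_hull_of N_def le_INF_iff le_principal)
      \<comment> \<open>As \<open>T s y\<close> lies in \<open>V\<close>, the preimage of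
        \<open>V\<close> under \<open>T s\<close> is an open neighbourhood of \<open>y\<close>, to
        which the convergence along \<open>q\<close> applies.\<close>
      have "eventually (\<lambda>t. s * t \<in> B V) q" if s: "s \<in> B V" for s
      proof -
        let ?W = "{z \<in> topspace X. T s z \<in> V}"
        have "openin X ?W"
          using X V by (auto simp: dynamical_system_def \<N>_def continuous_map_def)
        then have "?W \<in> \<N>"
          using s y by (simp add: \<N>_def B_def)
        then have "eventually (\<lambda>t. t \<in> B ?W) q"
          using q by (rule ev[rotated])
        then show ?thesis
          by (rule eventually_mono) (use X x y in \<open>auto simp: B_def dynamical_system_def\<close>)
      qed
      then have "eventually (\<lambda>s. eventually (\<lambda>t. s * t \<in> B V) q) p"
        using ev[OF p V] by (auto elim: eventually_mono)
      then show "p \<odot> q \<le> principal (B V)"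
        by (simp add: le_principal eventually_filter_mult)
    qed
    ultimately show "p \<odot> q \<in> hull_of (inf (Sup ?K) N)"
      by (simp add: mem_hull_of)
  qed
  ultimately obtain p where p: "p \<in> hull_of (inf (Sup ?K) N)" "p \<odot> p = p"
    by (rule idempotent_exists)
  obtain V where "V \<in> \<N>" "V \<subseteq> U"
    using U by (auto simp: neighbourhood_in_def \<N>_def)
  then have "eventually (\<lambda>s. T s x \<in> U) N"
    by (auto simp: N B_def)
  then have "eventually (\<lambda>s. T s x \<in> U) p"
    using p(1) by (auto simp: mem_hull_of dest: filter_leD)
  then show ?thesis
    using p unfolding quasi_central_iff[OF F] by (auto simp: mem_hull_of)
qed

section \<open>The shift on 0-1 functions\<close>

text \<open>\<open>None\<close> plays the role of the identity adjoined to \<open>S\<close>.\<close>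

definition option_mult :: "'a::semigroup_mult option \<Rightarrow> 'a \<Rightarrow> 'a" where
  "option_mult t s = (case t of None \<Rightarrow> s | Some r \<Rightarrow> r * s)"

text \<open>Translating on the right makes \<open>shift s\<close> after \<open>shift t\<close> equal
  to \<open>shift (s * t)\<close>. Evaluating \<open>shift s f\<close> at \<open>None\<close>
  returns \<open>f (Some s)\<close>.\<close>

definition shift :: "'a::semigroup_mult \<Rightarrow> ('a option \<Rightarrow> bool) \<Rightarrow> 'a option \<Rightarrow> bool" where
  "shift s f = (\<lambda>t. f (Some (option_mult t s)))"

definition cantor_cube :: "('a \<Rightarrow> bool) topology" where
  "cantor_cube = product_topology (\<lambda>_. discrete_topology UNIV) UNIV"

lemma topspace_cantor_cube: "topspace cantor_cube = UNIV"
  by (simp add: cantor_cube_def)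

lemma dynamical_system_shift: "dynamical_system cantor_cube shift"
  unfolding dynamical_system_def
proof (intro conjI allI ballI)
  show "compact_space (cantor_cube :: ('a option \<Rightarrow> bool) topology)"
    by (simp add: cantor_cube_def compact_space_product_topology compact_space_discrete_topology)
  show "Hausdorff_space (cantor_cube :: ('a option \<Rightarrow> bool) topology)"
    by (simp add: cantor_cube_def Hausdorff_space_product_topology)
  show "continuous_map cantor_cube cantor_cube (shift s)" for s :: 'a
    by (auto simp: cantor_cube_def shift_def continuous_map_componentwise
        intro: continuous_map_product_projection)
  show "shift s (shift t x) = shift (s * t) x" for s t :: 'a and x
    by (auto simp: shift_def option_mult_def mult.assoc split: option.split)
qed

lemma openin_cantor_cube_coordinate: "openin cantor_cube {f. f i}"
proof -
  have "continuous_map cantor_cube (discrete_topology UNIV) (\<lambda>f. f i)"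
    unfolding cantor_cube_def by (rule continuous_map_product_projection) simp
  then have "openin cantor_cube {f \<in> topspace cantor_cube. f i \<in> {True}}"
    by (rule openin_continuous_map_preimage) simp
  then show ?thesis
    by (simp add: topspace_cantor_cube)
qed

lemma openin_cantor_cube_finite:
  assumes "openin cantor_cube V" "f \<in> V"
  obtains I where "finite I" "{g. \<forall>i\<in>I. g i = f i} \<subseteq> V"
proof -
  obtain D where D: "finite {i. D i \<noteq> UNIV}" "f \<in> Pi\<^sub>E UNIV D" "Pi\<^sub>E UNIV D \<subseteq> V"
    using assms unfolding cantor_cube_def openin_product_topology_alt by fastforce
  have "{g. \<forall>i\<in>{i. D i \<noteq> UNIV}. g i = f i} \<subseteq> V"
  proof
    fix g
    assume g: "g \<in> {g. \<forall>i\<in>{i. D i \<noteq> UNIV}. g i = f i}"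
    have "g i \<in> D i" for i
      using g D(2) by (cases "D i = UNIV") (auto simp: PiE_iff)
    then show "g \<in> V"
      using D(3) by (auto simp: PiE_iff)
  qed
  with D(1) show thesis
    by (rule that)
qed

lemma recurrent_if_quasi_central:
  fixes F :: "'a::semigroup_mult filter"
  assumes F: "F \<noteq> bot" "mult_closed (hull_of F)" and A: "quasi_central F A"
  obtains x y :: "'a option \<Rightarrow> bool" and U where "neighbourhood_in cantor_cube y U"
    "jointly_intermittently_uniformly_recurrent F cantor_cube shift x y"
    "A = {s. shift s x \<in> U}"
proof -
  let ?K = "ideal_kernel (hull_of F)"
  obtain p where p: "p \<in> ultrafilters" "p \<le> Sup ?K" "p \<odot> p = p" "eventually (\<lambda>s. s \<in> A) p"
    using A unfolding quasi_central_iff[OF F] by (auto simp: mem_hull_of)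
  \<comment> \<open>\<open>False\<close> at \<open>None\<close> is an arbitrary default:
    \<open>shift\<close> reads its argument only at \<open>Some\<close>.\<close>
  define x :: "'a option \<Rightarrow> bool" where "x = case_option False (\<lambda>s. s \<in> A)"
  \<comment> \<open>the limit of \<open>shift s x\<close> along \<open>p\<close>, equal to that of \<open>shift s y\<close> because \<open>p\<close> is idempotent\<close>
  define y where "y = (\<lambda>t. eventually (\<lambda>s. shift s x t) p)"
  define U where "U = {f :: 'a option \<Rightarrow> bool. f None}"
  have x_lim: "eventually (\<lambda>s. shift s x t = y t) p" for t
    using ultrafilter_not[OF p(1), of "\<lambda>s. shift s x t"] by (cases "y t") (auto simp: y_def)
  have y_iff: "y t \<longleftrightarrow> eventually (\<lambda>s. shift s y t) p" for t
  proof -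
    have "y t \<longleftrightarrow> eventually (\<lambda>s. shift s x t) (p \<odot> p)"
      by (simp add: y_def p(3))
    also have "\<dots> \<longleftrightarrow> eventually (\<lambda>s. eventually (\<lambda>r. shift (s * r) x t) p) p"
      by (rule eventually_filter_mult)
    also have "\<dots> \<longleftrightarrow> eventually (\<lambda>s. shift s y t) p"
      by (cases t) (simp_all add: y_def shift_def option_mult_def mult.assoc)
    finally show ?thesis .
  qed
  have y_lim: "eventually (\<lambda>s. shift s y t = y t) p" for t
    using ultrafilter_not[OF p(1), of "\<lambda>s. shift s y t"] y_iff[of t] by (cases "y t") auto
  have "y None"
    using p(4) by (simp add: y_def shift_def option_mult_def x_def)
  then have "neighbourhood_in cantor_cube y U"
    using openin_cantor_cube_coordinate[of None]
    by (auto simp: neighbourhood_in_def U_def topspace_cantor_cube)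
  moreover have "jointly_intermittently_uniformly_recurrent F cantor_cube shift x y"
    unfolding jointly_intermittently_uniformly_recurrent_def
  proof (intro allI impI)
    fix W
    assume "neighbourhood_in cantor_cube y W"
    then obtain V where V: "openin cantor_cube V" "y \<in> V" "V \<subseteq> W"
      by (auto simp: neighbourhood_in_def)
    obtain I where I: "finite I" "{g. \<forall>i\<in>I. g i = y i} \<subseteq> V"
      using V(1,2) by (rule openin_cantor_cube_finite)
    \<comment> \<open>Only the finitely many coordinates in \<open>I\<close> matter, so
      coordinatewise limits suffice.\<close>
    have "eventually (\<lambda>s. \<forall>t\<in>I. shift s x t = y t \<and> shift s y t = y t) p"
      using I(1) x_lim y_lim by (intro eventually_ball_finite) (auto intro: eventually_conj)
    then have *: "eventually (\<lambda>s. shift s x \<in> W \<and> shift s y \<in> W) p"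
      by (rule eventually_mono) (use I(2) V(3) in blast)
    \<comment> \<open>\<open>p\<close> is in the closure of the kernel, so each of its members
      belongs to some kernel element.\<close>
    have "\<exists>r\<in>?K. eventually (\<lambda>s. shift s x \<in> W \<and> shift s y \<in> W) r"
    proof (rule ccontr)
      assume neg: "\<not> ?thesis"
      have "eventually (\<lambda>s. \<not> (shift s x \<in> W \<and> shift s y \<in> W)) r" if "r \<in> ?K" for r
      proof -
        have "r \<in> ultrafilters"
          using that by (simp add: ideal_kernel_def mem_hull_of)
        from ultrafilter_not[OF this] show ?thesis
          using neg that by blast
      qed
      then have "eventually (\<lambda>s. \<not> (shift s x \<in> W \<and> shift s y \<in> W)) p"
        using p(2) by (simp add: le_filter_def eventually_Sup)
      with * show False
        using ultrafilter_not[OF p(1)] by blast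
    qed
    then show "piecewise_syndetic F {s. shift s x \<in> W \<and> shift s y \<in> W}"
      by (auto intro: piecewise_syndetic_if_kernel)
  qed
  moreover have "A = {s. shift s x \<in> U}"
    by (auto simp: U_def shift_def option_mult_def x_def)
  ultimately show thesis
    by (rule that)
qed

(* HOL cannot quantify existentially over the type of points of a dynamical system.  The first
   conjunct is the equivalence with the existential ranging over all systems whose points are
   0-1 functions on S with an identity adjoined; the second gives the backward
   implication for systems on an arbitrary type. *)
theorem theorem4p7:
  fixes F :: "'a::semigroup_mult filter" and A :: "'a set"
  assumes "F \<noteq> bot"
    and "closed_subsemigroup (hull_of F)"
  shows
    "(quasi_central F A \<longleftrightarrow>
       (\<exists>(X :: ('a option \<Rightarrow> bool) topology) T x y U.
          dynamical_system X T \<and> x \<in> topspace X \<and> y \<in> topspace X \<and> neighbourhood_in X y U \<and>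
          jointly_intermittently_uniformly_recurrent F X T x y \<and> A = {s. T s x \<in> U})) \<and>
     ((\<exists>(X :: 'b topology) T x y U.
          dynamical_system X T \<and> x \<in> topspace X \<and> y \<in> topspace X \<and> neighbourhood_in X y U \<and>
          jointly_intermittently_uniformly_recurrent F X T x y \<and> A = {s. T s x \<in> U})
       \<longrightarrow> quasi_central F A)"
proof -
  have mc: "mult_closed (hull_of F)"
    using assms(2) by (simp add: closed_subsemigroup_def mult_closed_def)
  show ?thesis
  proof (intro conjI iffI impI)
    assume "quasi_central F A"
    then obtain x y U where "neighbourhood_in cantor_cube y U"
      "jointly_intermittently_uniformly_recurrent F cantor_cube shift x y"
      "A = {s. shift s x \<in> U}"
      by (rule recurrent_if_quasi_central[OF assms(1) mc])
    then show "\<exists>(X :: ('a option \<Rightarrow> bool) topology) T x y U.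
        dynamical_system X T \<and> x \<in> topspace X \<and> y \<in> topspace X \<and> neighbourhood_in X y U \<and>
        jointly_intermittently_uniformly_recurrent F X T x y \<and> A = {s. T s x \<in> U}"
      by (intro exI[of _ cantor_cube] exI[of _ shift] exI[of _ x] exI[of _ y] exI[of _ U] conjI)
        (simp_all add: dynamical_system_shift topspace_cantor_cube)
  next
    show "quasi_central F A"
      if "\<exists>(X :: ('a option \<Rightarrow> bool) topology) T x y U.
        dynamical_system X T \<and> x \<in> topspace X \<and> y \<in> topspace X \<and> neighbourhood_in X y U \<and>
        jointly_intermittently_uniformly_recurrent F X T x y \<and> A = {s. T s x \<in> U}"
      using that by (elim exE conjE) (simp add: quasi_central_if_recurrent[OF assms(1) mc])
    show "quasi_central F A"
      if "\<exists>(X :: 'b topology) T x y U.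
        dynamical_system X T \<and> x \<in> topspace X \<and> y \<in> topspace X \<and> neighbourhood_in X y U \<and>
        jointly_intermittently_uniformly_recurrent F X T x y \<and> A = {s. T s x \<in> U}"
      using that by (elim exE conjE) (simp add: quasi_central_if_recurrent[OF assms(1) mc])
  qed
qed

end
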